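(* Let $H_1,H_2$ be real Hilbert spaces. For each $i\in\{1,2\}$, let $C_i:H_i\to 2^{H_i}$ be a set-valued mapping with nonempty, closed and convex values; let $f_i:H_i\to H_i$ be $\alpha_i$-strongly monotone with respect to $g_i$ and $\beta_i$-Lipschitz continuous, where $g_i:H_i\to H_i$ is $\delta_i$-Lipschitz continuous and $g_i-I_i$ is $\sigma_i$-strongly monotone, $I_i$ being the identity operator on $H_i$ (all of $\alpha_i,\beta_i,\delta_i,\sigma_i$ are positive constants). Let $A:H_1\to H_2$ be a bounded linear operator with adjoint $A^*$. Assume that for each $i\in\{1,2\}$ there is a constant $\nu_i>0$ such that $$\|P_{C_i(x_i)}(z_i)-P_{C_i(y_i)}(z_i)\|\le \nu_i\|x_i-y_i\|\qquad\text{for all } x_i,y_i,z_i\in H_i.$$ Suppose $x_1^*\in H_1$ is a solution of the split general quasi-variational inequality problem, i.e. $g_1(x_1^* )\in C_1(x_1^* )$ and $$\langle f_1(x_1^* ),x_1-g_1(x_1^* )\rangle\ge 0\quad\text{for all }x_1\in C_1(x_1^* ),$$ and $x_2^*=Ax_1^*$ satisfies $g_2(x_2^* )\in C_2(x_2^* )$ and $$\langle f_2(x_2^* ),x_2-g_2(x_2^* )\rangle\ge 0\quad\text{for all }x_2\in C_2(x_2^* ).$$ Let $\{\alpha^n\}\subseteq(0,1)$ be a sequence with $\sum_{n=1}^\infty\alpha^n=+\infty$ (here $n$ is an index, not a power), let $\rho_1,\rho_2,\gamma>0$, let $x_1^0\in H_1$ be given, and let $\{x_1^n\}$, $\{y^n\}$,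 $\{z^n\}$ be generated, for $n=0,1,2,\dots$, by $$g_1(y^n)=P_{C_1(x_1^n)}\big(g_1(x_1^n)-\rho_1f_1(x_1^n)\big),$$ $$g_2(z^n)=P_{C_2(Ay^n)}\big(g_2(Ay^n)-\rho_2f_2(Ay^n)\big),$$ $$x_1^{n+1}=(1-\alpha^n)x_1^n+\alpha^n\big[y^n+\gamma A^*(z^n-Ay^n)\big].$$ Suppose that the constants satisfy $$\left|\rho_1-\frac{\alpha_1}{\beta_1^2}\right|<\frac{\sqrt{\alpha_1^2-\beta_1^2(\delta_1^2-k_1^2)}}{\beta_1^2},$$ $$\alpha_1>\beta_1\sqrt{\delta_1^2-k_1^2},\qquad k_1=\frac{\sqrt{2\sigma_1+1}}{1+2\theta_2}-\nu_1,\qquad \delta_1>|k_1|,$$ $$0<\theta_2=\frac{1}{\sqrt{2\sigma_2+1}}\left\{\sqrt{\delta_2^2-2\rho_2\alpha_2+\rho_2^2\beta_2^2}+\nu_2\right\},\qquad \rho_2>0,\qquad \gamma\in\left(0,\frac{2}{\|A\|^2}\right).$$ Then the sequence $\{x_1^n\}$ converges strongly (i.e. in norm) to $x_1^*$.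
   Context: For a nonempty closed convex subset $C$ of a real Hilbert space $H$, $P_C:H\to C$ denotes the metric projection: $P_C(x)$ is the unique point of $C$ nearest to $x$. $2^{H}$ denotes the family of all nonempty subsets of $H$. Let $f,g:H\to H$. The mapping $f$ is $\alpha$-strongly monotone ($\alpha>0$) if $\langle f(x)-f(\bar x),x-\bar x\rangle\ge\alpha\|x-\bar x\|^2$ for all $x,\bar x\in H$; it is $\alpha$-strongly monotone with respect to $g$ ($\alpha>0$) if $\langle f(x)-f(\bar x),g(x)-g(\bar x)\rangle\ge\alpha\|x-\bar x\|^2$ for all $x,\bar x\in H$; it is $\beta$-Lipschitz continuous ($\beta>0$) if $\|f(x)-f(\bar x)\|\le\beta\|x-\bar x\|$ for all $x,\bar x\in H$.
   Formalization: The formal theorem adds the assumption k_1 > 0; with k_1 < 0 the claim as printed is false (e.g. on R with A = id, f_i(u) = u, g_i(u) = 2u, C_1(u) = {5u/2}, C_2(u) = R the iterates can diverge). For A = 0 the bound 2/||A||^2 is read as +infinity. *)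

theory Defs
  imports "HOL-Analysis.Analysis"
begin

text \<open>
  The library's \<open>closest_point\<close> lives in class \<^class>\<open>heine_borel\<close>, i.e. in finite dimension, so the
  metric projection is defined here for arbitrary inner product spaces. It is meaningful when the
  nearest point exists uniquely, as it does for nonempty closed convex sets in a Hilbert space.
\<close>

definition metric_projection :: "'a::real_inner set \<Rightarrow> 'a \<Rightarrow> 'a" where
  "metric_projection C x = (THE p. p \<in> C \<and> (\<forall>y\<in>C. dist x p \<le> dist x y))"

definition strongly_monotone_wrt ::
    "real \<Rightarrow> ('a::real_inner \<Rightarrow> 'a) \<Rightarrow> ('a \<Rightarrow> 'a) \<Rightarrow> bool" where
  "strongly_monotone_wrt \<alpha> g f \<longleftrightarrow>
     \<alpha> > 0 \<and> (\<forall>x y. inner (f x - f y) (g x - g y) \<ge> \<alpha> * (norm (x - y))\<^sup>2)"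

definition strongly_monotone :: "real \<Rightarrow> ('a::real_inner \<Rightarrow> 'a) \<Rightarrow> bool" where
  "strongly_monotone \<alpha> f \<longleftrightarrow>
     \<alpha> > 0 \<and> (\<forall>x y. inner (f x - f y) (x - y) \<ge> \<alpha> * (norm (x - y))\<^sup>2)"

definition gqvi_solution ::
    "('a::real_inner \<Rightarrow> 'a set) \<Rightarrow> ('a \<Rightarrow> 'a) \<Rightarrow> ('a \<Rightarrow> 'a) \<Rightarrow> 'a \<Rightarrow> bool" where
  "gqvi_solution C f g x \<longleftrightarrow> g x \<in> C x \<and> (\<forall>u\<in>C x. inner (f x) (u - g x) \<ge> 0)"

definition split_gqvi_solution ::
    "('a::real_inner \<Rightarrow> 'a set) \<Rightarrow> ('a \<Rightarrow> 'a) \<Rightarrow> ('a \<Rightarrow> 'a) \<Rightarrow>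
     ('b::real_inner \<Rightarrow> 'b set) \<Rightarrow> ('b \<Rightarrow> 'b) \<Rightarrow> ('b \<Rightarrow> 'b) \<Rightarrow>
     ('a \<Rightarrow> 'b) \<Rightarrow> 'a \<Rightarrow> bool" where
  "split_gqvi_solution C1 f1 g1 C2 f2 g2 A x \<longleftrightarrow>
     gqvi_solution C1 f1 g1 x \<and> gqvi_solution C2 f2 g2 (A x)"

end

theory Submission
  imports Defs
begin

text \<open>
  Write \<open>e n = norm (x n - xstar)\<close>. A solution \<open>s\<close> is a fixed point of the projection step, because
  the variational inequality says that \<open>g s\<close> is the projection of \<open>g s - \<rho> f s\<close> onto \<open>C s\<close>. Since
  projections are nonexpansive and \<open>g\<close> expands distances by at least \<open>sqrt (2\<sigma> + 1)\<close>, each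
  projection step contracts distances to \<open>s\<close> by
  \<open>\<theta> = (sqrt (\<delta>\<^sup>2 - 2\<rho>\<alpha> + \<rho>\<^sup>2\<beta>\<^sup>2) + \<nu>) / sqrt (2\<sigma> + 1)\<close>. As \<open>\<gamma> \<parallel>A\<parallel>\<^sup>2 \<le> 2\<close>, the map
  \<open>I - \<gamma> A\<^sup>* A\<close> is nonexpansive and the correction by \<open>z n\<close> costs at most a factor \<open>1 + 2\<theta>\<^sub>2\<close>.
  Hence \<open>e (n + 1) \<le> (1 - a n (1 - \<theta>\<^sub>1 (1 + 2\<theta>\<^sub>2))) e n\<close>, where the conditions on the constants
  ensure \<open>\<theta>\<^sub>1 (1 + 2\<theta>\<^sub>2) < 1\<close>, and divergence of \<open>\<Sum> a n\<close> drives \<open>e n\<close> to \<open>0\<close>.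
\<close>

section \<open>Metric projections in Hilbert spaces\<close>

text \<open>The midpoint of \<open>p\<close> and \<open>q\<close> stays in \<open>C\<close> by
  convexity, so its distance to \<open>x\<close> is at least \<open>d\<close>; the parallelogram
  identity turns this into the bound. It serves both existence and uniqueness of nearest
  points.\<close>

lemma convex_dist_parallelogram:
  fixes x :: "'a::real_inner"
  assumes "convex C" "p \<in> C" "q \<in> C" "0 \<le> d" and low: "\<And>y. y \<in> C \<Longrightarrow> d \<le> dist x y"
  shows "(dist p q)\<^sup>2 \<le> 2 * (dist x p)\<^sup>2 + 2 * (dist x q)\<^sup>2 - 4 * d\<^sup>2"
proof -
  define m where "m = (1/2) *\<^sub>R p + (1/2) *\<^sub>R q"
  have "m \<in> C"
    unfolding m_def using assms(1-3) by (intro convexD) auto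
  then have "d\<^sup>2 \<le> (norm (x - m))\<^sup>2"
    using low[of m] \<open>0 \<le> d\<close> by (simp add: dist_norm power_mono)
  moreover have "(norm (p - q))\<^sup>2 = 2 * (norm (x - p))\<^sup>2 + 2 * (norm (x - q))\<^sup>2 - 4 * (norm (x - m))\<^sup>2"
    unfolding m_def power2_norm_eq_inner
    by (simp add: inner_diff_left inner_diff_right inner_add_left inner_add_right
        inner_commute algebra_simps)
  ultimately show ?thesis by (simp add: dist_norm)
qed

text \<open>Completeness supplies the limit of a minimising sequence, and closedness keeps it in
  \<open>C\<close>. This makes the definite description in \<open>metric_projection\<close>
  meaningful.\<close>

lemma ex1_nearest_point:
  fixes C :: "'a::{real_inner,complete_space} set"
  assumes "C \<noteq> {}" "closed C" "convex C"
  shows "\<exists>!p. p \<in> C \<and> (\<forall>y\<in>C. dist x p \<le> dist x y)"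
proof (rule ex_ex1I)
  define d where "d = infdist x C"
  have d0: "0 \<le> d" unfolding d_def by (rule infdist_nonneg)
  have low: "d \<le> dist x y" if "y \<in> C" for y
    unfolding d_def using that by (rule infdist_le)
  \<comment> \<open>The error is put on the squared distance so that the terms in \<open>d\<close>
    cancel in the parallelogram bound and only the two errors survive, doubled.\<close>
  have "\<exists>p\<in>C. (dist x p)\<^sup>2 < d\<^sup>2 + inverse (real (Suc n))" for n
  proof -
    have "sqrt (d\<^sup>2 + inverse (real (Suc n))) > d"
      using d0 by (simp add: real_less_rsqrt)
    then obtain p where "p \<in> C" "dist x p < sqrt (d\<^sup>2 + inverse (real (Suc n)))"
      using infdist_notempty[OF assms(1), of x] cINF_less_iff[of C "\<lambda>y. dist x y"] assms(1)
      unfolding d_def by auto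
    then have "(dist x p)\<^sup>2 < (sqrt (d\<^sup>2 + inverse (real (Suc n))))\<^sup>2"
      by (intro power_strict_mono) auto
    with \<open>p \<in> C\<close> show ?thesis by auto
  qed
  then obtain p where pC: "\<And>n. p n \<in> C"
    and pd: "\<And>n. (dist x (p n))\<^sup>2 < d\<^sup>2 + inverse (real (Suc n))"
    by metis
  have pq: "(dist (p m) (p n))\<^sup>2 \<le> 2 * inverse (real (Suc m)) + 2 * inverse (real (Suc n))" for m n
    using convex_dist_parallelogram[OF assms(3) pC[of m] pC[of n] d0 low] pd[of m] pd[of n]
    by simp
  have "Cauchy p"
  proof (rule metric_CauchyI)
    fix e :: real assume "0 < e"
    then obtain N where N: "inverse (real (Suc N)) < e\<^sup>2 / 4"
      using reals_Archimedean[of "e\<^sup>2 / 4"] by auto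
    have "dist (p m) (p n) < e" if "N \<le> m" "N \<le> n" for m n
    proof -
      have "inverse (real (Suc m)) \<le> inverse (real (Suc N))"
        "inverse (real (Suc n)) \<le> inverse (real (Suc N))"
        using that by (auto intro!: le_imp_inverse_le)
      then have "(dist (p m) (p n))\<^sup>2 < e\<^sup>2" using pq[of m n] N by linarith
      then show ?thesis by (rule power_less_imp_less_base) (use \<open>0 < e\<close> in simp)
    qed
    then show "\<exists>N. \<forall>m\<ge>N. \<forall>n\<ge>N. dist (p m) (p n) < e" by blast
  qed
  then obtain l where l: "p \<longlonglongrightarrow> l" using Cauchy_convergent convergent_def by blast
  have "l \<in> C" using closed_sequentially[OF assms(2) _ l] pC by blast
  have "(\<lambda>n. (dist x (p n))\<^sup>2) \<longlonglongrightarrow> (dist x l)\<^sup>2" by (intro tendsto_intros l)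
  moreover have "(\<lambda>n. d\<^sup>2 + inverse (real (Suc n))) \<longlonglongrightarrow> d\<^sup>2 + 0"
    by (intro tendsto_intros LIMSEQ_inverse_real_of_nat)
  ultimately have "(dist x l)\<^sup>2 \<le> d\<^sup>2"
    using pd by (intro LIMSEQ_le[where Y = "\<lambda>n. d\<^sup>2 + inverse (real (Suc n))"]) (auto intro: less_imp_le)
  then have "dist x l \<le> d" using d0 by (rule power2_le_imp_le)
  then show "\<exists>p. p \<in> C \<and> (\<forall>y\<in>C. dist x p \<le> dist x y)"
    using \<open>l \<in> C\<close> low order_trans by blast
next
  fix p q
  assume p: "p \<in> C \<and> (\<forall>y\<in>C. dist x p \<le> dist x y)" and q: "q \<in> C \<and> (\<forall>y\<in>C. dist x q \<le> dist x y)"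
  then have "dist x p = dist x q" by (simp add: order_antisym)
  \<comment> \<open>Both distances equal the lower bound \<open>d = dist x p\<close>, so the
    right-hand side vanishes.\<close>
  then have "(dist p q)\<^sup>2 \<le> 0"
    using convex_dist_parallelogram[OF assms(3), of p q "dist x p" x] p q by simp
  then show "p = q" by simp
qed

lemma metric_projection_nearest:
  fixes C :: "'a::{real_inner,complete_space} set"
  assumes "C \<noteq> {}" "closed C" "convex C"
  shows "metric_projection C x \<in> C" "y \<in> C \<Longrightarrow> dist x (metric_projection C x) \<le> dist x y"
  using theI'[OF ex1_nearest_point[OF assms, of x]] unfolding metric_projection_def by blast+

text \<open>A positive inner product would let a small move from the projection towards
  \<open>y\<close> come closer to \<open>x\<close>, and convexity keeps that move inside
  \<open>C\<close>.\<close>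

lemma metric_projection_inner_le:
  fixes C :: "'a::{real_inner,complete_space} set"
  assumes "C \<noteq> {}" "closed C" "convex C" "y \<in> C"
  shows "inner (x - metric_projection C x) (y - metric_projection C x) \<le> 0"
proof (rule ccontr)
  let ?p = "metric_projection C x"
  assume "\<not> ?thesis"
  then have "0 < inner (x - ?p) (y - ?p)" by simp
  from closer_point_lemma[OF this] obtain u where u: "u > 0" "u \<le> 1" "dist (?p + u *\<^sub>R (y - ?p)) x < dist ?p x"
    by blast
  have "(1 - u) *\<^sub>R ?p + u *\<^sub>R y \<in> C"
    using u assms metric_projection_nearest(1)[OF assms(1-3)] by (intro convexD) auto
  then have "?p + u *\<^sub>R (y - ?p) \<in> C" by (simp add: algebra_simps)
  from metric_projection_nearest(2)[OF assms(1-3) this, of x] u(3) show False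
    by (simp add: dist_commute)
qed

text \<open>Converse of the obtuse-angle inequality: \<open>p\<close> and the projection both
  satisfy it, and testing each with the other and adding leaves the squared distance between
  them.\<close>

lemma metric_projection_eqI:
  fixes C :: "'a::{real_inner,complete_space} set"
  assumes "C \<noteq> {}" "closed C" "convex C" "p \<in> C"
    and vi: "\<And>y. y \<in> C \<Longrightarrow> inner (x - p) (y - p) \<le> 0"
  shows "metric_projection C x = p"
proof -
  let ?q = "metric_projection C x"
  have "inner (x - p) (?q - p) \<le> 0" using vi metric_projection_nearest(1)[OF assms(1-3)] by blast
  moreover have "inner (x - ?q) (p - ?q) \<le> 0" by (rule metric_projection_inner_le[OF assms(1-4)])
  moreover have "inner (x - p) (?q - p) + inner (x - ?q) (p - ?q) = (norm (?q - p))\<^sup>2"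
    unfolding power2_norm_eq_inner by (simp add: algebra_simps inner_commute)
  ultimately have "(norm (?q - p))\<^sup>2 \<le> 0" by linarith
  then show ?thesis by simp
qed

text \<open>Testing each projection against the other gives firm nonexpansiveness, and
  Cauchy-Schwarz finishes.\<close>

lemma metric_projection_nonexpansive:
  fixes C :: "'a::{real_inner,complete_space} set"
  assumes "C \<noteq> {}" "closed C" "convex C"
  shows "norm (metric_projection C x - metric_projection C y) \<le> norm (x - y)"
proof -
  let ?p = "metric_projection C x" and ?q = "metric_projection C y"
  have "inner (x - ?p) (?q - ?p) \<le> 0" "inner (y - ?q) (?p - ?q) \<le> 0"
    using metric_projection_inner_le[OF assms] metric_projection_nearest(1)[OF assms] by auto
  moreover have "inner (x - ?p) (?q - ?p) + inner (y - ?q) (?p - ?q)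
      = (norm (?p - ?q))\<^sup>2 - inner (x - y) (?p - ?q)"
    unfolding power2_norm_eq_inner by (simp add: algebra_simps inner_commute)
  ultimately have "(norm (?p - ?q))\<^sup>2 \<le> inner (x - y) (?p - ?q)" by linarith
  also have "\<dots> \<le> norm (x - y) * norm (?p - ?q)" by (rule norm_cauchy_schwarz)
  finally show ?thesis
    by (cases "?p = ?q") (auto simp: power2_eq_square)
qed

section \<open>Adjoints in Hilbert spaces\<close>

lemma riesz_representation:
  fixes \<phi> :: "'a::{real_inner,complete_space} \<Rightarrow> real"
  assumes "bounded_linear \<phi>"
  shows "\<exists>u. \<forall>v. \<phi> v = inner v u"
proof (cases "\<forall>v. \<phi> v = 0")
  case True
  then show ?thesis by (intro exI[of _ 0]) simp
next
  case False
  interpret bounded_linear \<phi> by fact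
  obtain w where w: "\<phi> w \<noteq> 0" using False by blast
  \<comment> \<open>The point of least norm in this hyperplane is orthogonal to the kernel of \<open>\<phi>\<close>.\<close>
  define C where "C = {v. \<phi> v = 1}"
  have C: "C \<noteq> {}" "closed C" "convex C"
  proof -
    have "(1 / \<phi> w) *\<^sub>R w \<in> C" using w by (simp add: C_def scaleR)
    then show "C \<noteq> {}" by blast
    show "closed C"
      unfolding C_def by (intro closed_Collect_eq continuous_on continuous_on_id continuous_on_const)
    show "convex C" unfolding C_def convex_def by (simp add: add scaleR)
  qed
  define p where "p = metric_projection C 0"
  have p1: "\<phi> p = 1" using metric_projection_nearest(1)[OF C] by (simp add: p_def C_def)
  have ge: "0 \<le> inner p v" if "\<phi> v = 0" for v
  proof -
    have "p + v \<in> C" using that p1 by (simp add: C_def add)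
    from metric_projection_inner_le[OF C this, of 0] show ?thesis by (simp add: p_def)
  qed
  have orth: "inner p v = 0" if "\<phi> v = 0" for v
    using ge[of v] ge[of "- v"] that by (simp add: neg)
  \<comment> \<open>Subtracting \<open>\<phi> v *\<^sub>R p\<close> from \<open>v\<close> lands in
    the kernel, since \<open>\<phi> p = 1\<close>; orthogonality to \<open>p\<close> then forces the
    normalisation by the squared norm of \<open>p\<close>.\<close>
  have "\<phi> v = inner v ((1 / (norm p)\<^sup>2) *\<^sub>R p)" for v
  proof -
    have "inner p (v - \<phi> v *\<^sub>R p) = 0" by (rule orth) (simp add: diff scaleR p1)
    then have "inner v p = \<phi> v * (norm p)\<^sup>2"
      by (simp add: inner_diff_right power2_norm_eq_inner inner_commute)
    moreover have "p \<noteq> 0" using p1 zero by auto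
    ultimately show ?thesis by simp
  qed
  then show ?thesis by blast
qed

text \<open>\<open>adjoint\<close> is a choice operator, so its defining property holds once some
  map has it; Riesz applied to \<open>inner (A v) w\<close> as a functional of \<open>v\<close>
  builds such a map pointwise.\<close>

lemma inner_adjoint_hilbert:
  fixes A :: "'a::{real_inner,complete_space} \<Rightarrow> 'b::real_inner"
  assumes "bounded_linear A"
  shows "inner x (adjoint A y) = inner (A x) y"
proof -
  have "\<exists>u. \<forall>v. inner (A v) w = inner v u" for w
    by (rule riesz_representation)
      (rule bounded_linear_compose[OF bounded_linear_inner_left assms])
  then have "\<exists>B. \<forall>x y. inner (A x) y = inner x (B y)" by metis
  then have "\<forall>x y. inner (A x) y = inner x (adjoint A y)"
    unfolding adjoint_def by (rule someI_ex)
  then show ?thesis by metis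
qed

lemma norm_adjoint_le:
  fixes A :: "'a::{real_inner,complete_space} \<Rightarrow> 'b::real_inner"
  assumes "bounded_linear A"
  shows "norm (adjoint A y) \<le> onorm A * norm y"
proof -
  let ?b = "adjoint A y"
  have "norm ?b * norm ?b = inner (A ?b) y"
    using inner_adjoint_hilbert[OF assms, of ?b y] by (simp flip: power2_norm_eq_inner power2_eq_square)
  also have "\<dots> \<le> norm (A ?b) * norm y" by (rule norm_cauchy_schwarz)
  also have "\<dots> \<le> onorm A * norm ?b * norm y"
    by (intro mult_right_mono onorm[OF assms]) simp
  finally have "norm ?b * norm ?b \<le> norm ?b * (onorm A * norm y)" by (simp add: mult_ac)
  then show ?thesis
    by (cases "?b = 0") (simp_all add: onorm_pos_le[OF assms])
qed

lemma adjoint_diff_hilbert: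
  fixes A :: "'a::{real_inner,complete_space} \<Rightarrow> 'b::real_inner"
  assumes "bounded_linear A"
  shows "adjoint A (u - v) = adjoint A u - adjoint A v"
proof -
  have "inner x (adjoint A (u - v)) = inner x (adjoint A u - adjoint A v)" for x
    by (simp add: inner_diff_right inner_adjoint_hilbert[OF assms])
  then show ?thesis by (rule vector_eq_ldot[THEN iffD1, OF allI])
qed

text \<open>In the expanded square, the quadratic term in \<gamma> is at most
  \<open>\<gamma> * (onorm A)\<^sup>2\<close> times \<open>\<gamma> * (norm (A d))\<^sup>2\<close>,
  hence is absorbed by the cross term.\<close>

lemma gradient_step_nonexpansive:
  fixes A :: "'a::{real_inner,complete_space} \<Rightarrow> 'b::real_inner"
  assumes A: "bounded_linear A" and "0 \<le> \<gamma>" and g: "\<gamma> * (onorm A)\<^sup>2 \<le> 2"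
  shows "norm (d - \<gamma> *\<^sub>R adjoint A (A d)) \<le> norm d"
proof -
  let ?b = "adjoint A (A d)"
  have "(norm ?b)\<^sup>2 \<le> (onorm A)\<^sup>2 * (norm (A d))\<^sup>2"
    using power_mono[OF norm_adjoint_le[OF A, of "A d"], of 2] by (simp add: power_mult_distrib)
  then have "\<gamma>\<^sup>2 * (norm ?b)\<^sup>2 \<le> \<gamma>\<^sup>2 * ((onorm A)\<^sup>2 * (norm (A d))\<^sup>2)"
    by (simp add: mult_left_mono)
  also have "\<dots> = (\<gamma> * (onorm A)\<^sup>2) * (\<gamma> * (norm (A d))\<^sup>2)"
    by (simp add: power2_eq_square)
  also have "\<dots> \<le> 2 * (\<gamma> * (norm (A d))\<^sup>2)"
    by (rule mult_right_mono[OF g]) (simp add: \<open>0 \<le> \<gamma>\<close>)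
  finally have *: "\<gamma>\<^sup>2 * (norm ?b)\<^sup>2 \<le> 2 * \<gamma> * (norm (A d))\<^sup>2" by simp
  have "(norm (d - \<gamma> *\<^sub>R ?b))\<^sup>2 = (norm d)\<^sup>2 - 2 * \<gamma> * inner d ?b + \<gamma>\<^sup>2 * (norm ?b)\<^sup>2"
    unfolding power2_norm_eq_inner by (simp add: algebra_simps inner_commute power2_eq_square)
  also have "inner d ?b = (norm (A d))\<^sup>2"
    by (simp add: inner_adjoint_hilbert[OF A] power2_norm_eq_inner)
  finally have "(norm (d - \<gamma> *\<^sub>R ?b))\<^sup>2 \<le> (norm d)\<^sup>2" using * by linarith
  then show ?thesis by (rule power2_le_imp_le) simp
qed

section \<open>The projection step and the averaged iteration\<close>

text \<open>Write the increment of \<open>g\<close> as that of \<open>g - I\<close> plus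
  \<open>u - v\<close> and expand the square: the cross term yields \<open>2 * \<sigma>\<close>, the
  identity part yields 1, and the remaining square is dropped.\<close>

lemma strongly_monotone_minus_id_expansive:
  assumes "strongly_monotone \<sigma> (\<lambda>u. g u - u)"
  shows "sqrt (2 * \<sigma> + 1) * norm (u - v) \<le> norm (g u - g v)"
proof -
  have "\<sigma> * (norm (u - v))\<^sup>2 \<le> inner ((g u - u) - (g v - v)) (u - v)" and s: "0 < \<sigma>"
    using assms unfolding strongly_monotone_def by blast+
  moreover have "(norm (g u - g v))\<^sup>2 = (norm ((g u - u) - (g v - v)))\<^sup>2
      + 2 * inner ((g u - u) - (g v - v)) (u - v) + (norm (u - v))\<^sup>2"
    unfolding power2_norm_eq_inner by (simp add: algebra_simps inner_commute)
  moreover have "0 \<le> (norm ((g u - u) - (g v - v)))\<^sup>2" by simp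
  ultimately have "2 * (\<sigma> * (norm (u - v))\<^sup>2) + (norm (u - v))\<^sup>2 \<le> (norm (g u - g v))\<^sup>2"
    by linarith
  then have "(2 * \<sigma> + 1) * (norm (u - v))\<^sup>2 \<le> (norm (g u - g v))\<^sup>2"
    by (simp add: distrib_right)
  then have "(sqrt (2 * \<sigma> + 1) * norm (u - v))\<^sup>2 \<le> (norm (g u - g v))\<^sup>2"
    using s by (simp add: power_mult_distrib)
  then show ?thesis by (rule power2_le_imp_le) simp
qed

text \<open>Expand the square: the Lipschitz constants bound the two pure terms, and strong
  monotonicity of \<open>f\<close> relative to \<open>g\<close> bounds the cross term.\<close>

lemma strongly_monotone_wrt_step_bound:
  assumes f: "strongly_monotone_wrt \<alpha> g f" "\<beta>-lipschitz_on UNIV f"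
    and g: "\<delta>-lipschitz_on UNIV g" and "0 \<le> \<rho>"
  shows "norm ((g v - \<rho> *\<^sub>R f v) - (g s - \<rho> *\<^sub>R f s))
    \<le> sqrt (\<delta>\<^sup>2 - 2 * \<rho> * \<alpha> + \<rho>\<^sup>2 * \<beta>\<^sup>2) * norm (v - s)"
proof -
  define G F where "G = g v - g s" and "F = f v - f s"
  have "norm G \<le> \<delta> * norm (v - s)"
    using lipschitz_onD[OF g, of v s] by (simp add: G_def dist_norm)
  then have G: "(norm G)\<^sup>2 \<le> \<delta>\<^sup>2 * (norm (v - s))\<^sup>2"
    using power_mono[of "norm G" "\<delta> * norm (v - s)" 2] by (simp add: power_mult_distrib)
  have "norm F \<le> \<beta> * norm (v - s)"
    using lipschitz_onD[OF f(2), of v s] by (simp add: F_def dist_norm)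
  then have "(norm F)\<^sup>2 \<le> \<beta>\<^sup>2 * (norm (v - s))\<^sup>2"
    using power_mono[of "norm F" "\<beta> * norm (v - s)" 2] by (simp add: power_mult_distrib)
  then have F: "\<rho>\<^sup>2 * (norm F)\<^sup>2 \<le> \<rho>\<^sup>2 * (\<beta>\<^sup>2 * (norm (v - s))\<^sup>2)"
    by (rule mult_left_mono) simp
  have "\<alpha> * (norm (v - s))\<^sup>2 \<le> inner F G"
    using f(1) unfolding strongly_monotone_wrt_def F_def G_def by blast
  then have FG: "\<rho> * (\<alpha> * (norm (v - s))\<^sup>2) \<le> \<rho> * inner F G"
    using \<open>0 \<le> \<rho>\<close> by (rule mult_left_mono)
  have "(norm (G - \<rho> *\<^sub>R F))\<^sup>2 = (norm G)\<^sup>2 - 2 * (\<rho> * inner F G) + \<rho>\<^sup>2 * (norm F)\<^sup>2"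
    unfolding power2_norm_eq_inner by (simp add: algebra_simps inner_commute power2_eq_square)
  also have "\<dots> \<le> (\<delta>\<^sup>2 - 2 * \<rho> * \<alpha> + \<rho>\<^sup>2 * \<beta>\<^sup>2) * (norm (v - s))\<^sup>2"
    using F G FG by (simp add: algebra_simps)
  finally have "norm (G - \<rho> *\<^sub>R F) \<le> sqrt ((\<delta>\<^sup>2 - 2 * \<rho> * \<alpha> + \<rho>\<^sup>2 * \<beta>\<^sup>2) * (norm (v - s))\<^sup>2)"
    by (rule real_le_rsqrt)
  moreover have "G - \<rho> *\<^sub>R F = (g v - \<rho> *\<^sub>R f v) - (g s - \<rho> *\<^sub>R f s)"
    by (simp add: G_def F_def algebra_simps)
  ultimately show ?thesis by (simp add: real_sqrt_mult)
qed

lemma gqvi_solution_projection: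
  fixes C :: "'a::{real_inner,complete_space} \<Rightarrow> 'a set"
  assumes C: "C s \<noteq> {}" "closed (C s)" "convex (C s)"
    and "gqvi_solution C f g s" "0 \<le> \<rho>"
  shows "g s = metric_projection (C s) (g s - \<rho> *\<^sub>R f s)"
proof (rule metric_projection_eqI[OF C, symmetric])
  show "g s \<in> C s" using assms(4) by (simp add: gqvi_solution_def)
  show "inner (g s - \<rho> *\<^sub>R f s - g s) (y - g s) \<le> 0" if "y \<in> C s" for y
    using assms(4,5) that by (simp add: gqvi_solution_def)
qed

lemma projection_step_contraction:
  fixes C :: "'a::{real_inner,complete_space} \<Rightarrow> 'a set"
  assumes C: "\<And>u. C u \<noteq> {} \<and> closed (C u) \<and> convex (C u)"
    and f: "strongly_monotone_wrt \<alpha> g f" "\<beta>-lipschitz_on UNIV f"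
    and g: "\<delta>-lipschitz_on UNIV g" "strongly_monotone \<sigma> (\<lambda>u. g u - u)"
    and proj: "\<And>u v w. norm (metric_projection (C u) w - metric_projection (C v) w) \<le> \<nu> * norm (u - v)"
    and sol: "gqvi_solution C f g s" and "0 \<le> \<rho>"
    and step: "g w = metric_projection (C v) (g v - \<rho> *\<^sub>R f v)"
  shows "norm (w - s) \<le> 1 / sqrt (2 * \<sigma> + 1) * (sqrt (\<delta>\<^sup>2 - 2 * \<rho> * \<alpha> + \<rho>\<^sup>2 * \<beta>\<^sup>2) + \<nu>) * norm (v - s)"
proof -
  let ?u = "g v - \<rho> *\<^sub>R f v" and ?t = "g s - \<rho> *\<^sub>R f s"
  have "g s = metric_projection (C s) ?t"
    using C sol \<open>0 \<le> \<rho>\<close> by (intro gqvi_solution_projection) auto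
  \<comment> \<open>The inserted projection of \<open>?t\<close> onto \<open>C v\<close> separates
    two effects: moving the point with the set fixed (nonexpansiveness), and moving the set with the
    point fixed (the constant \<nu>).\<close>
  then have "g w - g s = (metric_projection (C v) ?u - metric_projection (C v) ?t)
      + (metric_projection (C v) ?t - metric_projection (C s) ?t)"
    using step by simp
  then have "norm (g w - g s) \<le> norm (metric_projection (C v) ?u - metric_projection (C v) ?t)
      + norm (metric_projection (C v) ?t - metric_projection (C s) ?t)"
    by (metis norm_triangle_ineq)
  also have "\<dots> \<le> norm (?u - ?t) + \<nu> * norm (v - s)"
    using C by (intro add_mono proj metric_projection_nonexpansive) auto
  also have "\<dots> \<le> sqrt (\<delta>\<^sup>2 - 2 * \<rho> * \<alpha> + \<rho>\<^sup>2 * \<beta>\<^sup>2) * norm (v - s) + \<nu> * norm (v - s)"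
    by (intro add_right_mono strongly_monotone_wrt_step_bound f g \<open>0 \<le> \<rho>\<close>)
  finally have "sqrt (2 * \<sigma> + 1) * norm (w - s)
      \<le> (sqrt (\<delta>\<^sup>2 - 2 * \<rho> * \<alpha> + \<rho>\<^sup>2 * \<beta>\<^sup>2) + \<nu>) * norm (v - s)"
    using strongly_monotone_minus_id_expansive[OF g(2), of w s] by (simp add: distrib_right)
  moreover have "0 < sqrt (2 * \<sigma> + 1)" using g(2) by (simp add: strongly_monotone_def)
  ultimately show ?thesis by (simp add: field_simps)
qed

text \<open>Multiplying the radicand by \<open>\<beta>\<^sup>2\<close> completes the square to
  \<open>(\<rho> * \<beta>\<^sup>2 - \<alpha>)\<^sup>2 + \<beta>\<^sup>2 * \<delta>\<^sup>2 -
  \<alpha>\<^sup>2\<close>, which the condition on \<rho> compares with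
  \<open>\<beta>\<^sup>2 * k\<^sup>2\<close>. Positivity of \<open>k\<close> is what lets the
  comparison of squares pass to the root.\<close>

lemma contraction_constant_less:
  fixes \<alpha> \<beta> \<delta> \<rho> k :: real
  assumes "0 < \<beta>" "0 < k"
    and "\<bar>\<rho> - \<alpha> / \<beta>\<^sup>2\<bar> < sqrt (\<alpha>\<^sup>2 - \<beta>\<^sup>2 * (\<delta>\<^sup>2 - k\<^sup>2)) / \<beta>\<^sup>2"
  shows "sqrt (\<delta>\<^sup>2 - 2 * \<rho> * \<alpha> + \<rho>\<^sup>2 * \<beta>\<^sup>2) < k"
proof -
  let ?D = "\<alpha>\<^sup>2 - \<beta>\<^sup>2 * (\<delta>\<^sup>2 - k\<^sup>2)"
  have "\<bar>\<rho> * \<beta>\<^sup>2 - \<alpha>\<bar> = \<bar>\<rho> - \<alpha> / \<beta>\<^sup>2\<bar> * \<beta>\<^sup>2"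
  proof -
    have "\<rho> * \<beta>\<^sup>2 - \<alpha> = (\<rho> - \<alpha> / \<beta>\<^sup>2) * \<beta>\<^sup>2"
      using \<open>0 < \<beta>\<close> by (simp add: left_diff_distrib)
    then show ?thesis by (simp add: abs_mult)
  qed
  also have "\<dots> < sqrt ?D"
    using assms(1,3) by (simp add: pos_less_divide_eq)
  finally have lt: "\<bar>\<rho> * \<beta>\<^sup>2 - \<alpha>\<bar> < sqrt ?D" .
  \<comment> \<open>\<open>sqrt\<close> is negative at negative arguments, so its positivity
    certifies that \<open>?D\<close> is positive and that squaring recovers it.\<close>
  then have "0 < sqrt ?D" by linarith
  then have "(sqrt ?D)\<^sup>2 = ?D" by simp
  with lt have "(\<rho> * \<beta>\<^sup>2 - \<alpha>)\<^sup>2 < ?D"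
    using power_strict_mono[of "\<bar>\<rho> * \<beta>\<^sup>2 - \<alpha>\<bar>" "sqrt ?D" 2] by simp
  then have "\<beta>\<^sup>2 * (\<delta>\<^sup>2 - 2 * \<rho> * \<alpha> + \<rho>\<^sup>2 * \<beta>\<^sup>2) < \<beta>\<^sup>2 * k\<^sup>2"
    by (simp add: power2_eq_square algebra_simps)
  then have "\<delta>\<^sup>2 - 2 * \<rho> * \<alpha> + \<rho>\<^sup>2 * \<beta>\<^sup>2 < k\<^sup>2"
    using \<open>0 < \<beta>\<close> by (subst (asm) mult_less_cancel_left_pos) auto
  then show ?thesis using \<open>0 < k\<close> by (intro real_less_lsqrt) auto
qed

lemma averaged_contraction_tendsto_zero:
  fixes e a :: "nat \<Rightarrow> real"
  assumes "\<And>n. 0 \<le> e n" "0 < c" and step: "\<And>n. e (Suc n) \<le> (1 - c * a n) * e n"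
    and div: "filterlim (\<lambda>N. \<Sum>n=1..N. a n) at_top sequentially"
  shows "e \<longlonglongrightarrow> 0"
proof -
  \<comment> \<open>Unrolling stops at \<open>e 1\<close> because the divergent sum starts at index
    1. Each factor is bounded by \<open>1 - t \<le> exp (- t)\<close>, which holds whatever the sign
    of the factor.\<close>
  have bound: "e (Suc n) \<le> exp (- (c * (\<Sum>k=1..n. a k))) * e 1" for n
  proof (induction n)
    case 0
    then show ?case by simp
  next
    case (Suc n)
    have "e (Suc (Suc n)) \<le> (1 - c * a (Suc n)) * e (Suc n)" by (rule step)
    also have "\<dots> \<le> exp (- (c * a (Suc n))) * e (Suc n)"
      using exp_ge_add_one_self[of "- (c * a (Suc n))"] by (intro mult_right_mono assms) simp
    also have "\<dots> \<le> exp (- (c * a (Suc n))) * (exp (- (c * (\<Sum>k=1..n. a k))) * e 1)"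
      by (intro mult_left_mono Suc.IH) simp
    also have "\<dots> = exp (- (c * (\<Sum>k=1..Suc n. a k))) * e 1"
      by (simp add: exp_add[symmetric] algebra_simps)
    finally show ?case .
  qed
  have "filterlim (\<lambda>n. c * (\<Sum>k=1..n. a k)) at_top sequentially"
    using filterlim_tendsto_pos_mult_at_top[OF tendsto_const \<open>0 < c\<close> div] .
  then have "(\<lambda>n. exp (- (c * (\<Sum>k=1..n. a k)))) \<longlonglongrightarrow> 0"
    by (intro filterlim_compose[OF exp_at_bot])
      (simp add: filterlim_uminus_at_bot)
  then have "(\<lambda>n. exp (- (c * (\<Sum>k=1..n. a k))) * e 1) \<longlonglongrightarrow> 0"
    by (rule tendsto_mult_left_zero)
  then have "(\<lambda>n. e (Suc n)) \<longlonglongrightarrow> 0"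
    by (rule Lim_null_comparison[rotated]) (use bound assms(1) in simp)
  then show ?thesis by (rule LIMSEQ_imp_Suc)
qed

text \<open>Splitting \<open>z - A y\<close> at \<open>A s\<close> leaves the nonexpansive step
  \<open>I - \<gamma> A* A\<close> on \<open>y - s\<close> plus the error of \<open>z\<close> pulled
  back by the adjoint.\<close>

lemma split_correction_bound:
  fixes A :: "'a::{real_inner,complete_space} \<Rightarrow> 'b::real_inner"
  assumes A: "bounded_linear A" and "0 \<le> \<gamma>" and g: "\<gamma> * (onorm A)\<^sup>2 \<le> 2" and "0 \<le> \<theta>"
    and z: "norm (z - A s) \<le> \<theta> * norm (A y - A s)"
  shows "norm (y + \<gamma> *\<^sub>R adjoint A (z - A y) - s) \<le> (1 + 2 * \<theta>) * norm (y - s)"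
proof -
  interpret bounded_linear A by fact
  have "z - A y = (z - A s) - A (y - s)" by (simp add: diff)
  then have "y + \<gamma> *\<^sub>R adjoint A (z - A y) - s
      = ((y - s) - \<gamma> *\<^sub>R adjoint A (A (y - s))) + \<gamma> *\<^sub>R adjoint A (z - A s)"
    by (simp only: adjoint_diff_hilbert[OF A] scaleR_diff_right) simp
  then have "norm (y + \<gamma> *\<^sub>R adjoint A (z - A y) - s)
      \<le> norm ((y - s) - \<gamma> *\<^sub>R adjoint A (A (y - s))) + \<gamma> * norm (adjoint A (z - A s))"
    using norm_triangle_ineq[of "(y - s) - \<gamma> *\<^sub>R adjoint A (A (y - s))"] \<open>0 \<le> \<gamma>\<close>
    by (metis abs_of_nonneg norm_scaleR)
  also have "\<dots> \<le> norm (y - s) + 2 * \<theta> * norm (y - s)"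
  proof (rule add_mono)
    show "norm ((y - s) - \<gamma> *\<^sub>R adjoint A (A (y - s))) \<le> norm (y - s)"
      by (rule gradient_step_nonexpansive[OF A \<open>0 \<le> \<gamma>\<close> g])
    have "norm (adjoint A (z - A s)) \<le> onorm A * norm (z - A s)" by (rule norm_adjoint_le[OF A])
    also have "\<dots> \<le> onorm A * (\<theta> * (onorm A * norm (y - s)))"
      using z onorm[OF A, of "y - s"] \<open>0 \<le> \<theta>\<close>
      by (intro mult_left_mono onorm_pos_le[OF A]) (auto simp: diff intro: order_trans mult_left_mono)
    \<comment> \<open>One factor \<open>onorm A\<close> comes from the adjoint and one from
      \<open>A\<close> itself, so the bound on \<open>\<gamma> * (onorm A)\<^sup>2\<close> applies
      once more; this is the 2 in \<open>1 + 2 * \<theta>\<close>.\<close>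
    finally have "\<gamma> * norm (adjoint A (z - A s)) \<le> \<gamma> * (onorm A * (\<theta> * (onorm A * norm (y - s))))"
      using \<open>0 \<le> \<gamma>\<close> by (rule mult_left_mono)
    also have "\<dots> = (\<gamma> * (onorm A)\<^sup>2) * (\<theta> * norm (y - s))" by (simp add: power2_eq_square)
    also have "\<dots> \<le> 2 * (\<theta> * norm (y - s))"
      using \<open>0 \<le> \<theta>\<close> by (intro mult_right_mono g) simp
    finally show "\<gamma> * norm (adjoint A (z - A s)) \<le> 2 * \<theta> * norm (y - s)" by simp
  qed
  finally show ?thesis by (simp add: distrib_right)
qed

theorem theorem3p1:
  fixes C1 :: "'a::{real_inner,complete_space} \<Rightarrow> 'a set"
    and C2 :: "'b::{real_inner,complete_space} \<Rightarrow> 'b set"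
    and f1 g1 :: "'a \<Rightarrow> 'a" and f2 g2 :: "'b \<Rightarrow> 'b"
    and A :: "'a \<Rightarrow> 'b"
    and \<alpha>\<^sub>1 \<beta>\<^sub>1 \<delta>\<^sub>1 \<sigma>\<^sub>1 \<nu>\<^sub>1 \<rho>\<^sub>1 k\<^sub>1 :: real
    and \<alpha>\<^sub>2 \<beta>\<^sub>2 \<delta>\<^sub>2 \<sigma>\<^sub>2 \<nu>\<^sub>2 \<rho>\<^sub>2 \<theta>\<^sub>2 :: real
    and \<gamma> :: real and a :: "nat \<Rightarrow> real"
    and x y :: "nat \<Rightarrow> 'a" and z :: "nat \<Rightarrow> 'b"
    and xstar :: 'a
  assumes C1: "\<And>u. C1 u \<noteq> {} \<and> closed (C1 u) \<and> convex (C1 u)"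
    and C2: "\<And>u. C2 u \<noteq> {} \<and> closed (C2 u) \<and> convex (C2 u)"
    and f1_mono: "strongly_monotone_wrt \<alpha>\<^sub>1 g1 f1"
    and f2_mono: "strongly_monotone_wrt \<alpha>\<^sub>2 g2 f2"
    and f1_lip: "\<beta>\<^sub>1 > 0" "\<beta>\<^sub>1-lipschitz_on UNIV f1"
    and f2_lip: "\<beta>\<^sub>2 > 0" "\<beta>\<^sub>2-lipschitz_on UNIV f2"
    and g1_lip: "\<delta>\<^sub>1 > 0" "\<delta>\<^sub>1-lipschitz_on UNIV g1"
    and g2_lip: "\<delta>\<^sub>2 > 0" "\<delta>\<^sub>2-lipschitz_on UNIV g2"
    and g1_mono: "strongly_monotone \<sigma>\<^sub>1 (\<lambda>u. g1 u - u)"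
    and g2_mono: "strongly_monotone \<sigma>\<^sub>2 (\<lambda>u. g2 u - u)"
    and A: "bounded_linear A"
    and proj1: "\<nu>\<^sub>1 > 0"
      "\<And>u v w. norm (metric_projection (C1 u) w - metric_projection (C1 v) w) \<le> \<nu>\<^sub>1 * norm (u - v)"
    and proj2: "\<nu>\<^sub>2 > 0"
      "\<And>u v w. norm (metric_projection (C2 u) w - metric_projection (C2 v) w) \<le> \<nu>\<^sub>2 * norm (u - v)"
    and solution: "split_gqvi_solution C1 f1 g1 C2 f2 g2 A xstar"
    and a_range: "\<And>n. 0 < a n \<and> a n < 1"
    and a_diverges: "filterlim (\<lambda>N. \<Sum>n=1..N. a n) at_top sequentially"
    and rho_pos: "\<rho>\<^sub>1 > 0" "\<rho>\<^sub>2 > 0"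
    and y_step: "\<And>n. g1 (y n) = metric_projection (C1 (x n)) (g1 (x n) - \<rho>\<^sub>1 *\<^sub>R f1 (x n))"
    and z_step: "\<And>n. g2 (z n) = metric_projection (C2 (A (y n))) (g2 (A (y n)) - \<rho>\<^sub>2 *\<^sub>R f2 (A (y n)))"
    and x_step: "\<And>n. x (Suc n) = (1 - a n) *\<^sub>R x n + a n *\<^sub>R (y n + \<gamma> *\<^sub>R adjoint A (z n - A (y n)))"
    and rho1: "\<bar>\<rho>\<^sub>1 - \<alpha>\<^sub>1 / \<beta>\<^sub>1\<^sup>2\<bar> < sqrt (\<alpha>\<^sub>1\<^sup>2 - \<beta>\<^sub>1\<^sup>2 * (\<delta>\<^sub>1\<^sup>2 - k\<^sub>1\<^sup>2)) / \<beta>\<^sub>1\<^sup>2"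
    and alpha1: "\<alpha>\<^sub>1 > \<beta>\<^sub>1 * sqrt (\<delta>\<^sub>1\<^sup>2 - k\<^sub>1\<^sup>2)"
    and k1_eq: "k\<^sub>1 = sqrt (2 * \<sigma>\<^sub>1 + 1) / (1 + 2 * \<theta>\<^sub>2) - \<nu>\<^sub>1"
    and k1_pos: "k\<^sub>1 > 0"
    and delta1: "\<delta>\<^sub>1 > \<bar>k\<^sub>1\<bar>"
    and theta2_eq: "\<theta>\<^sub>2 = 1 / sqrt (2 * \<sigma>\<^sub>2 + 1) * (sqrt (\<delta>\<^sub>2\<^sup>2 - 2 * \<rho>\<^sub>2 * \<alpha>\<^sub>2 + \<rho>\<^sub>2\<^sup>2 * \<beta>\<^sub>2\<^sup>2) + \<nu>\<^sub>2)"
    and theta2_pos: "\<theta>\<^sub>2 > 0"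
    and gamma_pos: "\<gamma> > 0"
    and gamma_less: "onorm A \<noteq> 0 \<Longrightarrow> \<gamma> < 2 / (onorm A)\<^sup>2"
  shows "x \<longlonglongrightarrow> xstar"
proof -
  define \<theta> where "\<theta> = 1 / sqrt (2 * \<sigma>\<^sub>1 + 1) * (sqrt (\<delta>\<^sub>1\<^sup>2 - 2 * \<rho>\<^sub>1 * \<alpha>\<^sub>1 + \<rho>\<^sub>1\<^sup>2 * \<beta>\<^sub>1\<^sup>2) + \<nu>\<^sub>1)"
  have sols: "gqvi_solution C1 f1 g1 xstar" "gqvi_solution C2 f2 g2 (A xstar)"
    using solution by (simp_all add: split_gqvi_solution_def)
  have ybound: "norm (y n - xstar) \<le> \<theta> * norm (x n - xstar)" for n
    unfolding \<theta>_def
    by (rule projection_step_contraction[OF C1 f1_mono f1_lip(2) g1_lip(2) g1_mono proj1(2) sols(1) _ y_step])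
      (simp add: rho_pos less_imp_le)
  have zbound: "norm (z n - A xstar) \<le> \<theta>\<^sub>2 * norm (A (y n) - A xstar)" for n
    unfolding theta2_eq
    by (rule projection_step_contraction[OF C2 f2_mono f2_lip(2) g2_lip(2) g2_mono proj2(2) sols(2) _ z_step])
      (simp add: rho_pos less_imp_le)
  \<comment> \<open>For \<open>A = 0\<close> the interval for \<gamma> is unbounded, while
    \<open>2 / 0\<close> is 0 in HOL; hence the separate case.\<close>
  have \<gamma>A: "\<gamma> * (onorm A)\<^sup>2 \<le> 2"
  proof (cases "onorm A = 0")
    case False
    then show ?thesis using gamma_less by (simp add: pos_less_divide_eq less_imp_le)
  qed simp
  \<comment> \<open>\<open>k\<^sub>1\<close> is exactly the threshold for the root below which
    \<open>\<theta>\<close> times \<open>1 + 2 * \<theta>\<^sub>2\<close> drops under 1.\<close>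
  have "sqrt (\<delta>\<^sub>1\<^sup>2 - 2 * \<rho>\<^sub>1 * \<alpha>\<^sub>1 + \<rho>\<^sub>1\<^sup>2 * \<beta>\<^sub>1\<^sup>2) + \<nu>\<^sub>1 < sqrt (2 * \<sigma>\<^sub>1 + 1) / (1 + 2 * \<theta>\<^sub>2)"
    using contraction_constant_less[OF f1_lip(1) k1_pos rho1] k1_eq by simp
  moreover have "0 < sqrt (2 * \<sigma>\<^sub>1 + 1)" using g1_mono by (simp add: strongly_monotone_def)
  ultimately have "(1 + 2 * \<theta>\<^sub>2) * \<theta> < 1"
    unfolding \<theta>_def using theta2_pos by (simp add: pos_less_divide_eq mult.commute)
  then have c: "0 < 1 - (1 + 2 * \<theta>\<^sub>2) * \<theta>" by simp
  have "norm (x (Suc n) - xstar) \<le> (1 - (1 - (1 + 2 * \<theta>\<^sub>2) * \<theta>) * a n) * norm (x n - xstar)" for n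
  proof -
    let ?w = "y n + \<gamma> *\<^sub>R adjoint A (z n - A (y n))"
    have "norm (?w - xstar) \<le> (1 + 2 * \<theta>\<^sub>2) * norm (y n - xstar)"
      using split_correction_bound[OF A _ \<gamma>A _ zbound] gamma_pos theta2_pos by simp
    also have "\<dots> \<le> (1 + 2 * \<theta>\<^sub>2) * (\<theta> * norm (x n - xstar))"
      using theta2_pos by (intro mult_left_mono ybound) simp
    finally have w: "norm (?w - xstar) \<le> (1 + 2 * \<theta>\<^sub>2) * \<theta> * norm (x n - xstar)" by simp
    \<comment> \<open>The weights sum to 1, so \<open>xstar\<close> can be distributed over both
      terms of the average.\<close>
    have "x (Suc n) - xstar = (1 - a n) *\<^sub>R (x n - xstar) + a n *\<^sub>R (?w - xstar)"
      unfolding x_step by (simp add: algebra_simps)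
    then have "norm (x (Suc n) - xstar) \<le> (1 - a n) * norm (x n - xstar) + a n * norm (?w - xstar)"
      using norm_triangle_ineq[of "(1 - a n) *\<^sub>R (x n - xstar)" "a n *\<^sub>R (?w - xstar)"] a_range[of n]
      by simp
    also have "\<dots> \<le> (1 - a n) * norm (x n - xstar) + a n * ((1 + 2 * \<theta>\<^sub>2) * \<theta> * norm (x n - xstar))"
      using w a_range[of n] by (intro add_left_mono mult_left_mono) auto
    finally show ?thesis by (simp add: algebra_simps)
  qed
  then have "(\<lambda>n. norm (x n - xstar)) \<longlonglongrightarrow> 0"
    using averaged_contraction_tendsto_zero[OF _ c _ a_diverges, of "\<lambda>n. norm (x n - xstar)"] by simp
  then show ?thesis by (simp add: LIM_zero_iff tendsto_norm_zero_iff)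
qed

end
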